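(* Let $V$ be a nonempty open subset of $\ell^2$. Then there is a semi-anti-plurisubharmonic function $\Psi$ on $V$ such that: (i) $\Psi(\mathbf z)>0$ for all $\mathbf z\in V$; (ii) $\Psi$ is an exhaustion function on $V$; (iii) for every $S\stackrel{\circ}{\subset}V$, $$\sup_{\mathbf z,\zeta\in S,\ \mathbf z\ne\zeta}\left\{\Psi(\mathbf z)+\frac{|\Psi(\mathbf z)-\Psi(\zeta)|}{\|\mathbf z-\zeta\|}\right\}<\infty .$$
   Context: $\ell^2$ is the complex Hilbert space of square-summable complex sequences with its canonical norm $\|\cdot\|$. Uniform inclusion: for a nonempty bounded $S\subset V$ put $d(S,\partial V)=\inf\{\|\mathbf z_1-\mathbf z_2\|:\mathbf z_1\in S,\mathbf z_2\in\partial V\}$ if $V\ne\ell^2$ and $d(S,\partial V)=+\infty$ if $V=\ell^2$. $S$ is uniformly included in $V$, written $S\stackrel{\circ}{\subset}V$, if $S$ is bounded and $d(S,\partial V)>0$; the empty set is also counted as uniformly included. Exhaustion function on $V$: a real-valued function $\eta$ on $V$ such that $\{\mathbf z\in V:\eta(\mathbf z)\le t\}\stackrel{\circ}{\subset}V$ for every $t\in\mathbb R$. A real-valued continuous function $f$ on a nonempty open set $W\subset\ell^2$ is globally semi-anti-plurisubharmonic on $W$ with parameter $C$ ($C$ a real constant) if for each $\mathbf z\in W$, $\zeta\in\ell^2$ and $\delta>0$ there is $r\in(0,\delta)$ such that $\{\mathbf z+\rho e^{\sqrt{-1}\theta}\zeta:\rho\in[0,r],\theta\in[0,2\pi]\}\subset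 W$ and $$\frac1{2\pi}\int_0^{2\pi}\big(f(\mathbf z)-f(\mathbf z+re^{\sqrt{-1}\theta}\zeta)\big)\,d\theta\ge -Cr^2\|\zeta\|^2 .$$ A real-valued continuous function $f$ on $V$ is semi-anti-plurisubharmonic on $V$ if for each nonempty open set $S\stackrel{\circ}{\subset}V$ the restriction $f|_S$ is globally semi-anti-plurisubharmonic on $S$ with some parameter (which may depend on $S$). *)

theory Defs
  imports "HOL-Analysis.Analysis"
begin

section \<open>The complex Hilbert space of square-summable sequences\<close>

typedef ell2 = "{x :: nat \<Rightarrow> complex. summable (\<lambda>n. (cmod (x n))\<^sup>2)}"
  morphisms ell2_nth Abs_ell2
  by (rule exI[of _ "\<lambda>_. 0"]) simp

setup_lifting type_definition_ell2

lemma summable_ell2: "summable (\<lambda>n. (cmod (ell2_nth x n))\<^sup>2)"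
  using ell2_nth[of x] by simp

lemma ell2_eqI: "(\<And>n. ell2_nth x n = ell2_nth y n) \<Longrightarrow> x = y"
  by (simp add: ell2_nth_inject[symmetric] fun_eq_iff)

lemma square_summable_add:
  fixes x y :: "nat \<Rightarrow> complex"
  assumes "summable (\<lambda>n. (cmod (x n))\<^sup>2)" "summable (\<lambda>n. (cmod (y n))\<^sup>2)"
  shows "summable (\<lambda>n. (cmod (x n + y n))\<^sup>2)"
proof (rule summable_comparison_test')
  show "summable (\<lambda>n. 2 * (cmod (x n))\<^sup>2 + 2 * (cmod (y n))\<^sup>2)"
    by (intro summable_add summable_mult assms)
  fix n :: nat
  have "(cmod (x n + y n))\<^sup>2 \<le> (cmod (x n) + cmod (y n))\<^sup>2"
    by (intro power_mono norm_triangle_ineq) auto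
  also have "\<dots> \<le> 2 * (cmod (x n))\<^sup>2 + 2 * (cmod (y n))\<^sup>2"
    using sum_squares_bound[of "cmod (x n)" "cmod (y n)"] by (simp add: power2_sum)
  finally show "norm ((cmod (x n + y n))\<^sup>2) \<le> 2 * (cmod (x n))\<^sup>2 + 2 * (cmod (y n))\<^sup>2"
    by simp
qed

lemma square_summable_mult:
  fixes x :: "nat \<Rightarrow> complex"
  assumes "summable (\<lambda>n. (cmod (x n))\<^sup>2)"
  shows "summable (\<lambda>n. (cmod (c * x n))\<^sup>2)"
  using summable_mult[OF assms, of "(cmod c)\<^sup>2"] by (simp add: norm_mult power_mult_distrib)

instantiation ell2 :: real_vector
begin

lift_definition zero_ell2 :: ell2 is "\<lambda>_. 0" by simp
lift_definition plus_ell2 :: "ell2 \<Rightarrow> ell2 \<Rightarrow> ell2" is "\<lambda>x y n. x n + y n"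
  by (rule square_summable_add)
lift_definition uminus_ell2 :: "ell2 \<Rightarrow> ell2" is "\<lambda>x n. - x n" by simp
lift_definition minus_ell2 :: "ell2 \<Rightarrow> ell2 \<Rightarrow> ell2" is "\<lambda>x y n. x n - y n"
  subgoal for x y using square_summable_add[of x "\<lambda>n. - y n"] by simp
  done
lift_definition scaleR_ell2 :: "real \<Rightarrow> ell2 \<Rightarrow> ell2" is "\<lambda>r x n. r *\<^sub>R x n"
  subgoal for r x using square_summable_mult[of x "complex_of_real r"] by (simp add: scaleR_conv_of_real)
  done

instance
  by standard (transfer; simp add: algebra_simps)+

end

lift_definition scaleC_ell2 :: "complex \<Rightarrow> ell2 \<Rightarrow> ell2" (infixr "*\<^sub>C" 75)
  is "\<lambda>c x n. c * x n"
  by (rule square_summable_mult)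

lemma summable_inner_ell2: "summable (\<lambda>n. inner (ell2_nth x n) (ell2_nth y n))"
proof (rule summable_comparison_test')
  show "summable (\<lambda>n. (cmod (ell2_nth x n))\<^sup>2 + (cmod (ell2_nth y n))\<^sup>2)"
    by (intro summable_add summable_ell2)
  fix n :: nat
  have "\<bar>inner (ell2_nth x n) (ell2_nth y n)\<bar> \<le> cmod (ell2_nth x n) * cmod (ell2_nth y n)"
    by (rule Cauchy_Schwarz_ineq2)
  also have "\<dots> \<le> (cmod (ell2_nth x n))\<^sup>2 + (cmod (ell2_nth y n))\<^sup>2"
  proof -
    have "a * b \<le> a\<^sup>2 + b\<^sup>2" if "0 \<le> a" "0 \<le> b" for a b :: real
    proof -
      have "0 \<le> a * b" using that by simp
      then show ?thesis using sum_squares_bound[of a b] by linarith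
    qed
    then show ?thesis by simp
  qed
  finally show "norm (inner (ell2_nth x n) (ell2_nth y n)) \<le> (cmod (ell2_nth x n))\<^sup>2 + (cmod (ell2_nth y n))\<^sup>2"
    by simp
qed

text \<open>
  The class \<^class>\<open>real_inner\<close> supplies the real part of the Hermitian inner product; it induces
  the same norm.
\<close>

instantiation ell2 :: real_inner
begin

definition inner_ell2 :: "ell2 \<Rightarrow> ell2 \<Rightarrow> real" where
  "inner_ell2 x y = (\<Sum>n. inner (ell2_nth x n) (ell2_nth y n))"

definition norm_ell2 :: "ell2 \<Rightarrow> real" where
  "norm_ell2 x = sqrt (\<Sum>n. (cmod (ell2_nth x n))\<^sup>2)"

definition sgn_ell2 :: "ell2 \<Rightarrow> ell2" where
  "sgn_ell2 x = x /\<^sub>R norm x"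

definition dist_ell2 :: "ell2 \<Rightarrow> ell2 \<Rightarrow> real" where
  "dist_ell2 x y = norm (x - y)"

definition uniformity_ell2 :: "(ell2 \<times> ell2) filter" where
  "uniformity_ell2 = (INF e\<in>{0 <..}. principal {(x, y). dist x y < e})"

definition open_ell2 :: "ell2 set \<Rightarrow> bool" where
  "open_ell2 U = (\<forall>x\<in>U. \<forall>\<^sub>F (x', y) in uniformity. x' = x \<longrightarrow> y \<in> U)"

instance
proof
  fix x y z :: ell2 and r :: real
  show "inner x y = inner y x"
    by (simp add: inner_ell2_def inner_commute)
  show "inner (x + y) z = inner x z + inner y z"
    by (simp add: inner_ell2_def plus_ell2.rep_eq inner_add_left suminf_add summable_inner_ell2)
  show "inner (r *\<^sub>R x) y = r * inner x y"
    by (simp add: inner_ell2_def scaleR_ell2.rep_eq suminf_mult summable_inner_ell2)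
  show "0 \<le> inner x x"
    unfolding inner_ell2_def by (intro suminf_nonneg summable_inner_ell2) simp
  have "inner x x = 0 \<longleftrightarrow> (\<forall>n. inner (ell2_nth x n) (ell2_nth x n) = 0)"
    unfolding inner_ell2_def by (intro suminf_eq_zero_iff summable_inner_ell2) simp
  also have "\<dots> \<longleftrightarrow> x = 0"
    by (auto simp: zero_ell2.rep_eq intro: ell2_eqI)
  finally show "inner x x = 0 \<longleftrightarrow> x = 0" .
  show "norm x = sqrt (inner x x)"
    by (simp add: norm_ell2_def inner_ell2_def power2_norm_eq_inner)
qed (fact sgn_ell2_def dist_ell2_def uniformity_ell2_def open_ell2_def)+

end

lemma norm_ell2_power2: "(norm x)\<^sup>2 = (\<Sum>n. (cmod (ell2_nth x n))\<^sup>2)"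
  by (simp add: norm_ell2_def suminf_nonneg summable_ell2)

lemma norm_ell2_nth_le: "cmod (ell2_nth x n) \<le> norm x"
proof -
  have "(\<Sum>i\<in>{n}. (cmod (ell2_nth x i))\<^sup>2) \<le> (norm x)\<^sup>2"
    unfolding norm_ell2_power2 by (intro sum_le_suminf summable_ell2) auto
  then show ?thesis
    by (simp add: power2_le_iff_abs_le)
qed

lemma norm_scaleC_ell2: "norm (c *\<^sub>C x) = cmod c * norm x"
proof -
  have "(norm (c *\<^sub>C x))\<^sup>2 = (cmod c * norm x)\<^sup>2"
    by (simp add: norm_ell2_power2 scaleC_ell2.rep_eq norm_mult power_mult_distrib
        suminf_mult summable_ell2)
  then show ?thesis
    by (simp add: power2_eq_iff_nonneg)
qed

lemma scaleC_ell2_of_real: "complex_of_real r *\<^sub>C x = r *\<^sub>R x"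
  by (rule ell2_eqI) (simp add: scaleC_ell2.rep_eq scaleR_ell2.rep_eq scaleR_conv_of_real)

instance ell2 :: complete_space
proof
  fix X :: "nat \<Rightarrow> ell2"
  assume "Cauchy X"
  have "convergent (\<lambda>k. ell2_nth (X k) n)" for n
    unfolding convergent_eq_Cauchy[symmetric]
  proof (rule Cauchy_convergent, rule CauchyI)
    fix e :: real
    assume "e > 0"
    then obtain M where M: "\<And>k m. k \<ge> M \<Longrightarrow> m \<ge> M \<Longrightarrow> norm (X k - X m) < e"
      using CauchyD[OF \<open>Cauchy X\<close>] by blast
    have "cmod (ell2_nth (X k) n - ell2_nth (X m) n) < e" if "k \<ge> M" "m \<ge> M" for k m
      using le_less_trans[OF norm_ell2_nth_le M[OF that]] by (simp add: minus_ell2.rep_eq)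
    then show "\<exists>M. \<forall>k\<ge>M. \<forall>m\<ge>M. norm (ell2_nth (X k) n - ell2_nth (X m) n) < e"
      by blast
  qed
  then obtain f where f: "\<And>n. (\<lambda>k. ell2_nth (X k) n) \<longlonglongrightarrow> f n"
    unfolding convergent_def by metis
  have key: "summable (\<lambda>n. (cmod (ell2_nth (X k) n - f n))\<^sup>2) \<and>
      (\<Sum>n. (cmod (ell2_nth (X k) n - f n))\<^sup>2) \<le> e\<^sup>2"
    if M: "\<And>m. m \<ge> M \<Longrightarrow> norm (X k - X m) < e" for k M e
  proof -
    have part: "(\<Sum>n<N. (cmod (ell2_nth (X k) n - f n))\<^sup>2) \<le> e\<^sup>2" for N
    proof (rule tendsto_upperbound)
      show "(\<lambda>m. \<Sum>n<N. (cmod (ell2_nth (X k) n - ell2_nth (X m) n))\<^sup>2)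
          \<longlonglongrightarrow> (\<Sum>n<N. (cmod (ell2_nth (X k) n - f n))\<^sup>2)"
        by (intro tendsto_intros f)
      have "(\<Sum>n<N. (cmod (ell2_nth (X k) n - ell2_nth (X m) n))\<^sup>2) \<le> e\<^sup>2" if "m \<ge> M" for m
      proof -
        have "(\<Sum>n<N. (cmod (ell2_nth (X k - X m) n))\<^sup>2) \<le> (norm (X k - X m))\<^sup>2"
          unfolding norm_ell2_power2 by (intro sum_le_suminf summable_ell2) auto
        also have "\<dots> \<le> e\<^sup>2"
          using M[OF that] by (intro power_mono) auto
        finally show ?thesis by (simp add: minus_ell2.rep_eq)
      qed
      then show "\<forall>\<^sub>F m in sequentially.
          (\<Sum>n<N. (cmod (ell2_nth (X k) n - ell2_nth (X m) n))\<^sup>2) \<le> e\<^sup>2"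
        by (auto simp: eventually_sequentially)
    qed simp
    have "summable (\<lambda>n. (cmod (ell2_nth (X k) n - f n))\<^sup>2)"
      by (rule bounded_imp_summable[where B = "e\<^sup>2"])
         (use part[of "Suc _"] in \<open>simp_all add: lessThan_Suc_atMost\<close>)
    then show ?thesis
      using suminf_le_const part by blast
  qed
  obtain M where "\<And>m. m \<ge> M \<Longrightarrow> norm (X M - X m) < 1"
    using CauchyD[OF \<open>Cauchy X\<close>, of 1] by auto
  then have "summable (\<lambda>n. (cmod (ell2_nth (X M) n - f n))\<^sup>2)"
    using key by blast
  then have "summable (\<lambda>n. (cmod (ell2_nth (X M) n + - (ell2_nth (X M) n - f n)))\<^sup>2)"
    by (intro square_summable_add summable_ell2) (simp only: norm_minus_cancel)
  then have "summable (\<lambda>n. (cmod (f n))\<^sup>2)"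
    by simp
  then obtain L where L: "\<And>n. ell2_nth L n = f n"
    using that[of "Abs_ell2 f"] by (simp add: Abs_ell2_inverse)
  have "X \<longlonglongrightarrow> L"
  proof (rule LIMSEQ_I)
    fix e :: real
    assume "e > 0"
    then obtain M where M: "\<And>k m. k \<ge> M \<Longrightarrow> m \<ge> M \<Longrightarrow> norm (X k - X m) < e / 2"
      using CauchyD[OF \<open>Cauchy X\<close>, of "e / 2"] by auto
    have "norm (X k - L) < e" if "k \<ge> M" for k
    proof -
      have "(norm (X k - L))\<^sup>2 \<le> (e / 2)\<^sup>2"
        unfolding norm_ell2_power2 minus_ell2.rep_eq L
        using key[OF M[OF that], THEN conjunct2] by blast
      then have "norm (X k - L) \<le> e / 2"
        by (rule power2_le_imp_le) (use \<open>e > 0\<close> in simp)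
      then show ?thesis using \<open>e > 0\<close> by simp
    qed
    then show "\<exists>M. \<forall>k\<ge>M. norm (X k - L) < e" by blast
  qed
  then show "convergent X" by (rule convergentI)
qed


section \<open>Uniform inclusion, exhaustion and semi-anti-plurisubharmonicity\<close>

definition bdry_dist :: "ell2 set \<Rightarrow> ell2 set \<Rightarrow> ereal" where
  "bdry_dist S V = (if V = UNIV then \<infinity> else ereal (setdist S (frontier V)))"

text \<open>
  The empty set is treated separately because \<^const>\<open>setdist\<close> is \<open>0\<close> when an argument is empty.
  The other junk case of \<^const>\<open>setdist\<close> does not arise: if \<open>V\<close> is nonempty and
  \<open>V \<noteq> UNIV\<close>, then \<open>frontier V \<noteq> {}\<close>.
\<close>

definition uniformly_included :: "ell2 set \<Rightarrow> ell2 set \<Rightarrow> bool" where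
  "uniformly_included S V \<longleftrightarrow>
     S = {} \<or> (S \<subseteq> V \<and> bounded S \<and> bdry_dist S V > 0)"

definition exhaustion_function_on :: "ell2 set \<Rightarrow> (ell2 \<Rightarrow> real) \<Rightarrow> bool" where
  "exhaustion_function_on V \<eta> \<longleftrightarrow> (\<forall>t. uniformly_included {z \<in> V. \<eta> z \<le> t} V)"

definition globally_semi_anti_psh_on :: "real \<Rightarrow> ell2 set \<Rightarrow> (ell2 \<Rightarrow> real) \<Rightarrow> bool" where
  "globally_semi_anti_psh_on C W f \<longleftrightarrow>
     continuous_on W f \<and>
     (\<forall>z\<in>W. \<forall>\<zeta>. \<forall>\<delta>>0. \<exists>r. 0 < r \<and> r < \<delta> \<and>
        {z + (complex_of_real \<rho> * exp (\<i> * complex_of_real \<theta>)) *\<^sub>C \<zeta> | \<rho> \<theta>.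
           \<rho> \<in> {0..r} \<and> \<theta> \<in> {0..2 * pi}} \<subseteq> W \<and>
        1 / (2 * pi) * integral {0..2 * pi}
          (\<lambda>\<theta>. f z - f (z + (complex_of_real r * exp (\<i> * complex_of_real \<theta>)) *\<^sub>C \<zeta>))
        \<ge> - C * r\<^sup>2 * (norm \<zeta>)\<^sup>2)"

definition semi_anti_psh_on :: "ell2 set \<Rightarrow> (ell2 \<Rightarrow> real) \<Rightarrow> bool" where
  "semi_anti_psh_on V f \<longleftrightarrow>
     continuous_on V f \<and>
     (\<forall>S. open S \<and> S \<noteq> {} \<and> uniformly_included S V \<longrightarrow>
        (\<exists>C. globally_semi_anti_psh_on C S f))"

end

(*
  The squared distance to any set is semiconcave, being an infimum of the functions |z - w|^2.
  Exhaust V by the sets A_n of points at distance at least 2^{-n} from the complement of V and put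
  Psi z = 1 + |z|^2 + sum_n 4^{n+1} dist(z, A_n)^2. On A_m only the terms with n < m survive, so
  there Psi is semiconcave and Lipschitz on bounded sets. Conversely, a point outside A_m has
  distance at least 2^{-n-1} from A_n for each n < m, so each such term contributes at least 1.
  Averaging semiconcavity over pairs of antipodal points of a circle gives the integral inequality.
*)

theory Submission
  imports Defs
begin

section \<open>Semiconcave functions\<close>

text \<open>In an inner product space this is midpoint concavity of
  \<open>f z - C * (norm z)\<^sup>2\<close>. Only the three points have to lie in \<open>W\<close>,
  so \<open>W\<close> may be nonconvex.\<close>

definition semiconcave_on :: "real \<Rightarrow> 'a::real_normed_vector set \<Rightarrow> ('a \<Rightarrow> real) \<Rightarrow> bool" where
  "semiconcave_on C W f \<longleftrightarrow>
     (\<forall>z h. z \<in> W \<and> z + h \<in> W \<and> z - h \<in> W \<longrightarrow> f (z + h) + f (z - h) \<le> 2 * f z + 2 * C * (norm h)\<^sup>2)"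

lemma semiconcave_onD:
  "semiconcave_on C W f \<Longrightarrow> z \<in> W \<Longrightarrow> z + h \<in> W \<Longrightarrow> z - h \<in> W \<Longrightarrow>
    f (z + h) + f (z - h) \<le> 2 * f z + 2 * C * (norm h)\<^sup>2"
  by (auto simp: semiconcave_on_def)

lemma semiconcave_on_const: "semiconcave_on 0 W (\<lambda>_. c)"
  by (simp add: semiconcave_on_def)

lemma semiconcave_on_add:
  assumes "semiconcave_on C W f" "semiconcave_on D W g"
  shows "semiconcave_on (C + D) W (\<lambda>z. f z + g z)"
  unfolding semiconcave_on_def
proof (intro allI impI, elim conjE)
  fix z h assume z: "z \<in> W" "z + h \<in> W" "z - h \<in> W"
  show "f (z + h) + g (z + h) + (f (z - h) + g (z - h)) \<le> 2 * (f z + g z) + 2 * (C + D) * (norm h)\<^sup>2"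
    using semiconcave_onD[OF assms(1) z] semiconcave_onD[OF assms(2) z] by (simp add: algebra_simps)
qed

lemma semiconcave_on_cmult:
  assumes "semiconcave_on C W f" "0 \<le> c"
  shows "semiconcave_on (c * C) W (\<lambda>z. c * f z)"
  unfolding semiconcave_on_def
proof (intro allI impI, elim conjE)
  fix z h assume z: "z \<in> W" "z + h \<in> W" "z - h \<in> W"
  show "c * f (z + h) + c * f (z - h) \<le> 2 * (c * f z) + 2 * (c * C) * (norm h)\<^sup>2"
    using mult_left_mono[OF semiconcave_onD[OF assms(1) z] assms(2)] by (simp add: algebra_simps)
qed

lemma semiconcave_on_sum:
  assumes "finite I" "\<And>i. i \<in> I \<Longrightarrow> semiconcave_on (C i) W (f i)"
  shows "semiconcave_on (\<Sum>i\<in>I. C i) W (\<lambda>z. \<Sum>i\<in>I. f i z)"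
  using assms by (induction I rule: finite_induct) (auto intro: semiconcave_on_const semiconcave_on_add)

lemma semiconcave_on_cong:
  "(\<And>z. z \<in> W \<Longrightarrow> f z = g z) \<Longrightarrow> semiconcave_on C W f \<longleftrightarrow> semiconcave_on C W g"
  by (auto simp: semiconcave_on_def)

lemma norm_parallelogram:
  fixes x y :: "'a::real_inner"
  shows "(norm (x + y))\<^sup>2 + (norm (x - y))\<^sup>2 = 2 * (norm x)\<^sup>2 + 2 * (norm y)\<^sup>2"
  by (simp add: power2_norm_eq_inner inner_add_left inner_add_right inner_diff_left inner_diff_right
      inner_commute)

lemma semiconcave_on_norm_square:
  fixes W :: "'a::real_inner set"
  shows "semiconcave_on 1 W (\<lambda>z. (norm z)\<^sup>2)"
  by (simp add: semiconcave_on_def norm_parallelogram)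

text \<open>By the parallelogram law each \<open>(norm (z - w))\<^sup>2\<close> satisfies the
  inequality with equality and the same constant 1, so the bound survives the infimum over
  \<open>w\<close>.\<close>

lemma semiconcave_on_infdist_square:
  fixes A W :: "'a::real_inner set"
  shows "semiconcave_on 1 W (\<lambda>z. (infdist z A)\<^sup>2)"
proof (cases "A = {}")
  case True
  then show ?thesis by (simp add: semiconcave_on_def infdist_def)
next
  case False
  show ?thesis unfolding semiconcave_on_def
  proof (intro allI impI)
    fix z h :: 'a
    \<comment> \<open>\<open>K\<close> is the lower bound for \<open>(infdist z A)\<^sup>2\<close>
      that the inequality asks for; it is checked against each \<open>w\<close> in \<open>A\<close>
      separately.\<close>
    define K where "K = ((infdist (z + h) A)\<^sup>2 + (infdist (z - h) A)\<^sup>2) / 2 - (norm h)\<^sup>2"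
    have le: "K \<le> (dist z w)\<^sup>2" if "w \<in> A" for w
    proof -
      have "(infdist (z + h) A)\<^sup>2 \<le> (norm ((z - w) + h))\<^sup>2" "(infdist (z - h) A)\<^sup>2 \<le> (norm ((z - w) - h))\<^sup>2"
        using infdist_le[OF that, of "z + h"] infdist_le[OF that, of "z - h"]
        by (auto intro!: power_mono infdist_nonneg simp: dist_norm algebra_simps)
      then have "(infdist (z + h) A)\<^sup>2 + (infdist (z - h) A)\<^sup>2 \<le> 2 * (norm (z - w))\<^sup>2 + 2 * (norm h)\<^sup>2"
        unfolding norm_parallelogram[symmetric] by (rule add_mono)
      then show ?thesis by (simp add: K_def dist_norm field_simps)
    qed
    \<comment> \<open>\<open>K\<close> can be negative, hence the truncation at 0 before the root is
      taken.\<close>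
    have "sqrt (max K 0) \<le> infdist z A"
      unfolding infdist_notempty[OF False]
      by (rule cINF_greatest[OF False]) (use le in \<open>auto intro!: real_le_lsqrt\<close>)
    then have "K \<le> (infdist z A)\<^sup>2"
      using power_mono[of "sqrt (max K 0)" "infdist z A" 2] by simp
    then show "(infdist (z + h) A)\<^sup>2 + (infdist (z - h) A)\<^sup>2
        \<le> 2 * (infdist z A)\<^sup>2 + 2 * 1 * (norm h)\<^sup>2"
      by (simp add: K_def field_simps)
  qed
qed

section \<open>Circle averages\<close>

lemma bounded_linear_scaleC_ell2: "bounded_linear (\<lambda>c. c *\<^sub>C (x :: ell2))"
proof (rule bounded_linear_intro[where K = "norm x"])
  fix c d :: complex and r :: real
  show "(c + d) *\<^sub>C x = c *\<^sub>C x + d *\<^sub>C x"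
    by (rule ell2_eqI) (simp add: scaleC_ell2.rep_eq plus_ell2.rep_eq algebra_simps)
  show "(r *\<^sub>R c) *\<^sub>C x = r *\<^sub>R c *\<^sub>C x"
    by (rule ell2_eqI) (simp add: scaleC_ell2.rep_eq scaleR_ell2.rep_eq)
  show "norm (c *\<^sub>C x) \<le> norm c * norm x"
    by (simp add: norm_scaleC_ell2)
qed

text \<open>Shifting the half over \<open>{pi..2 * pi}\<close> back by \<open>pi\<close> pairs every
  angle with its antipode; the pair sums are at least \<open>2 * K\<close> on an interval of length
  \<open>pi\<close>.\<close>

lemma integral_circle_antipodal:
  fixes g :: "real \<Rightarrow> real"
  assumes "continuous_on UNIV g" "\<And>\<theta>. g \<theta> + g (\<theta> + pi) \<ge> 2 * K"
  shows "integral {0..2 * pi} g \<ge> 2 * pi * K"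
proof -
  have int: "g integrable_on {a..b}" "(\<lambda>\<theta>. g (\<theta> + pi)) integrable_on {a..b}" for a b
    by (intro integrable_continuous_interval continuous_on_compose2[OF assms(1)] continuous_intros; simp)+
  have "integral {0..2 * pi} g = integral {0..pi} g + integral {pi..2 * pi} g"
    by (intro Henstock_Kurzweil_Integration.integral_combine[symmetric] int) auto
  also have "integral {pi..2 * pi} g = integral {0..pi} (\<lambda>\<theta>. g (\<theta> + pi))"
    using integral_shift_real_ivl[of pi pi "2 * pi" g] by simp
  also have "integral {0..pi} g + \<dots> = integral {0..pi} (\<lambda>\<theta>. g \<theta> + g (\<theta> + pi))"
    by (intro integral_add[symmetric] int)
  also have "\<dots> \<ge> integral {0..pi} (\<lambda>_. 2 * K)"
    by (intro integral_le integrable_add int) (use assms(2) in auto)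
  finally show ?thesis by simp
qed

lemma semiconcave_imp_globally_semi_anti_psh_on:
  assumes "open W" "continuous_on W f" "semiconcave_on C W f"
  shows "globally_semi_anti_psh_on C W f"
  unfolding globally_semi_anti_psh_on_def
proof (intro conjI ballI allI impI)
  show "continuous_on W f" by fact
  fix z \<zeta> :: ell2 and \<delta> :: real
  assume z: "z \<in> W" and "\<delta> > 0"
  obtain e where e: "e > 0" "ball z e \<subseteq> W"
    using assms(1) z by (meson openE)
  \<comment> \<open>The half makes \<open>r < \<delta>\<close> strict; the \<open>+ 1\<close> covers
    \<open>\<zeta> = 0\<close> and gives \<open>r * norm \<zeta> < e\<close> strictly.\<close>
  define r where "r = min (\<delta> / 2) (e / (norm \<zeta> + 1))"
  have pos: "norm \<zeta> + 1 > 0" by (simp add: add_nonneg_pos)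
  have r: "0 < r" "r < \<delta>" using \<open>\<delta> > 0\<close> e pos by (auto simp: r_def min_less_iff_disj)
  have "r * (norm \<zeta> + 1) \<le> e" using pos by (simp add: r_def pos_le_divide_eq[symmetric])
  then have re: "r * norm \<zeta> < e" using r by (simp add: algebra_simps)
  define h where "h = (\<lambda>\<theta>. (complex_of_real r * exp (\<i> * complex_of_real \<theta>)) *\<^sub>C \<zeta>)"
  have in_W: "z + (complex_of_real \<rho> * exp (\<i> * complex_of_real \<theta>)) *\<^sub>C \<zeta> \<in> W"
    if "\<rho> \<in> {0..r}" for \<rho> \<theta>
  proof -
    have "\<rho> * norm \<zeta> \<le> r * norm \<zeta>" using that by (intro mult_right_mono) auto
    then show ?thesis using e re that
      by (auto intro!: subsetD[OF e(2)] simp: dist_norm norm_scaleC_ell2 norm_mult)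
  qed
  have h_in: "z + h \<theta> \<in> W" for \<theta>
    unfolding h_def using r by (intro in_W) auto
  have norm_h: "norm (h \<theta>) = r * norm \<zeta>" for \<theta>
    using r by (simp add: h_def norm_scaleC_ell2 norm_mult)
  \<comment> \<open>A half turn negates \<open>h\<close>, so antipodal points form the symmetric
    pair of \<open>semiconcave_on\<close>.\<close>
  have h_pi: "z + h (\<theta> + pi) = z - h \<theta>" for \<theta>
  proof -
    have "h (\<theta> + pi) = - h \<theta>"
      by (rule ell2_eqI)
         (simp add: h_def scaleC_ell2.rep_eq uminus_ell2.rep_eq exp_add distrib_left exp_pi_i')
    then show ?thesis by simp
  qed
  have cont_h: "continuous_on UNIV (\<lambda>\<theta>. z + h \<theta>)"
    unfolding h_def
    by (intro continuous_intros bounded_linear.continuous_on[OF bounded_linear_scaleC_ell2])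
  have "2 * pi * (- C * (r * norm \<zeta>)\<^sup>2) \<le> integral {0..2 * pi} (\<lambda>\<theta>. f z - f (z + h \<theta>))"
  proof (rule integral_circle_antipodal)
    show "continuous_on UNIV (\<lambda>\<theta>. f z - f (z + h \<theta>))"
      by (intro continuous_intros continuous_on_compose2[OF assms(2) cont_h]) (use h_in in auto)
    fix \<theta>
    show "f z - f (z + h \<theta>) + (f z - f (z + h (\<theta> + pi))) \<ge> 2 * (- C * (r * norm \<zeta>)\<^sup>2)"
      using semiconcave_onD[OF assms(3) z h_in[of \<theta>]] h_in[of "\<theta> + pi"]
      by (simp add: h_pi norm_h)
  qed
  then have "- C * r\<^sup>2 * (norm \<zeta>)\<^sup>2 \<le> 1 / (2 * pi) * integral {0..2 * pi} (\<lambda>\<theta>. f z - f (z + h \<theta>))"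
    by (simp add: field_simps power_mult_distrib)
  moreover have "{z + (complex_of_real \<rho> * exp (\<i> * complex_of_real \<theta>)) *\<^sub>C \<zeta> | \<rho> \<theta>.
      \<rho> \<in> {0..r} \<and> \<theta> \<in> {0..2 * pi}} \<subseteq> W"
    using in_W by blast
  ultimately show "\<exists>r. 0 < r \<and> r < \<delta> \<and>
      {z + (complex_of_real \<rho> * exp (\<i> * complex_of_real \<theta>)) *\<^sub>C \<zeta> | \<rho> \<theta>.
         \<rho> \<in> {0..r} \<and> \<theta> \<in> {0..2 * pi}} \<subseteq> W \<and>
      1 / (2 * pi) * integral {0..2 * pi}
        (\<lambda>\<theta>. f z - f (z + (complex_of_real r * exp (\<i> * complex_of_real \<theta>)) *\<^sub>C \<zeta>))
      \<ge> - C * r\<^sup>2 * (norm \<zeta>)\<^sup>2"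
    using r unfolding h_def by blast
qed

section \<open>The inner exhaustion of an open set\<close>

text \<open>
  Stated without \<^const>\<open>infdist\<close> so that every level is the whole space when \<open>V = UNIV\<close>
  (the distance to the empty set is \<open>0\<close> by convention).
\<close>

definition inner_level :: "'a::metric_space set \<Rightarrow> nat \<Rightarrow> 'a set" where
  "inner_level V n = {z. \<forall>w. w \<notin> V \<longrightarrow> 1 / 2 ^ n \<le> dist z w}"

lemma inner_level_subset: "inner_level V n \<subseteq> V"
proof
  fix z assume "z \<in> inner_level V n"
  then have "1 / 2 ^ n \<le> dist z z" if "z \<notin> V"
    using that unfolding inner_level_def by blast
  then show "z \<in> V" by (metis dist_self not_le zero_less_divide_1_iff zero_less_numeral zero_less_power)
qed

lemma inner_level_mono:
  assumes "m \<le> n"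
  shows "inner_level V m \<subseteq> inner_level V n"
proof -
  have "(1::real) / 2 ^ n \<le> 1 / 2 ^ m"
    using assms by (intro frac_le power_increasing) auto
  then show ?thesis
    unfolding inner_level_def by (blast intro: order_trans)
qed

text \<open>Any \<open>n\<close> with \<open>1 / 2 ^ n < e\<close> works for all centres at once;
  this turns radii into levels.\<close>

lemma ball_subset_imp_inner_level:
  assumes "e > 0"
  obtains n where "{z. ball z e \<subseteq> V} \<subseteq> inner_level V n"
proof -
  obtain n where n: "(1 / 2) ^ n < e"
    using real_arch_pow_inv[OF assms, of "1 / 2"] by auto
  have "1 / 2 ^ n \<le> dist z w" if "ball z e \<subseteq> V" "w \<notin> V" for z w
  proof -
    have "e \<le> dist z w" using that by (meson mem_ball not_less subsetD)
    then show ?thesis using n by (simp add: power_one_over)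
  qed
  then have "{z. ball z e \<subseteq> V} \<subseteq> inner_level V n"
    unfolding inner_level_def by blast
  then show ?thesis by (rule that)
qed

text \<open>Points within half the radius of \<open>z\<close> still have a ball of that half radius
  inside \<open>V\<close>. A whole neighbourhood thus lies in one level, which makes the series for
  \<open>exh\<close> locally finite on \<open>V\<close>.\<close>

lemma open_ex_ball_subset_inner_level:
  assumes "open V" "z \<in> V"
  obtains e n where "e > 0" "ball z e \<subseteq> inner_level V n"
proof -
  obtain e where e: "e > 0" "ball z e \<subseteq> V" using assms by (meson openE)
  obtain n where n: "{z. ball z (e / 2) \<subseteq> V} \<subseteq> inner_level V n"
    using ball_subset_imp_inner_level[of "e / 2"] e by auto
  have "ball z (e / 2) \<subseteq> {z. ball z (e / 2) \<subseteq> V}"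
  proof (rule subsetI, rule CollectI)
    fix y assume y: "y \<in> ball z (e / 2)"
    show "ball y (e / 2) \<subseteq> V"
    proof (rule order_trans[OF _ e(2)], rule subsetI)
      fix x assume "x \<in> ball y (e / 2)"
      then show "x \<in> ball z e" using y dist_triangle[of z x y] by simp
    qed
  qed
  then show ?thesis using that[of "e / 2" n] e n by (meson half_gt_zero order_trans)
qed

text \<open>Some \<open>w\<close> outside \<open>V\<close> is closer to \<open>z\<close> than half
  of \<open>1 / 2 ^ k\<close>, while level \<open>k\<close> keeps distance \<open>1 / 2 ^ k\<close>
  from \<open>w\<close>; the triangle inequality leaves the other half. Nonemptiness excludes the
  default value 0 of \<open>infdist\<close>.\<close>

lemma inner_level_gap:
  assumes "z \<notin> inner_level V m" "k < m" "inner_level V k \<noteq> {}"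
  shows "1 / 2 ^ Suc k \<le> infdist z (inner_level V k)"
proof -
  obtain w where w: "w \<notin> V" "dist z w < 1 / 2 ^ m"
    using assms(1) by (auto simp: inner_level_def not_le)
  have "(1::real) / 2 ^ m \<le> 1 / 2 ^ Suc k"
    using \<open>k < m\<close> by (intro frac_le power_increasing) auto
  then have zw: "dist z w < 1 / 2 ^ Suc k" using w by linarith
  show ?thesis
    unfolding infdist_notempty[OF assms(3)]
  proof (rule cINF_greatest[OF assms(3)])
    fix a assume "a \<in> inner_level V k"
    then have "1 / 2 ^ k \<le> dist a w" using w by (auto simp: inner_level_def)
    moreover have "(1::real) / 2 ^ k = 1 / 2 ^ Suc k + 1 / 2 ^ Suc k" by simp
    ultimately show "1 / 2 ^ Suc k \<le> dist z a"
      using zw dist_triangle[of a w z] dist_commute[of a z] by linarith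
  qed
qed

section \<open>Inner levels and uniform inclusion\<close>

lemma ball_subset_of_frontier:
  fixes z :: "'a::real_normed_vector"
  assumes "z \<in> V" "\<And>p. p \<in> frontier V \<Longrightarrow> e \<le> dist z p"
  shows "ball z e \<subseteq> V"
proof (rule ccontr)
  assume not_subset: "\<not> ball z e \<subseteq> V"
  then obtain x where "dist z x < e" by (auto simp: subset_iff)
  then have "z \<in> ball z e" using le_less_trans[OF zero_le_dist] by auto
  \<comment> \<open>A ball is connected, so it cannot meet both \<open>V\<close> and its complement
    without meeting the frontier.\<close>
  then have "ball z e \<inter> frontier V \<noteq> {}"
    using assms(1) not_subset by (intro connected_Int_frontier connected_ball) blast+
  then show False using assms(2) by force
qed

lemma uniformly_included_imp_inner_level:
  assumes "uniformly_included S V"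
  obtains m where "S \<subseteq> inner_level V m"
proof (cases "S = {} \<or> V = UNIV")
  case True
  then have "S \<subseteq> inner_level V 0" by (auto simp: inner_level_def)
  then show ?thesis by (rule that)
next
  case False
  then have S: "S \<subseteq> V" "setdist S (frontier V) > 0"
    using assms by (auto simp: uniformly_included_def bdry_dist_def)
  obtain n where n: "{z. ball z (setdist S (frontier V)) \<subseteq> V} \<subseteq> inner_level V n"
    using ball_subset_imp_inner_level[OF S(2)] .
  show ?thesis
  proof (rule that[of n], rule subsetI)
    fix z assume "z \<in> S"
    then have "ball z (setdist S (frontier V)) \<subseteq> V"
      using S by (intro ball_subset_of_frontier setdist_le_dist) auto
    then show "z \<in> inner_level V n" using n by blast
  qed
qed

text \<open>Frontier points of an open set lie outside it, so the distance bound of level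
  \<open>m\<close> applies to them.\<close>

lemma inner_level_imp_uniformly_included:
  assumes "open V" "bounded S" "S \<subseteq> inner_level V m"
  shows "uniformly_included S V"
proof (cases "S = {} \<or> V = UNIV")
  case True
  then show ?thesis using assms(2) by (auto simp: uniformly_included_def bdry_dist_def)
next
  case False
  have SV: "S \<subseteq> V" using assms(3) inner_level_subset by blast
  \<comment> \<open>An empty frontier would make \<open>setdist\<close> equal to 0 by
    convention.\<close>
  have "frontier V \<noteq> {}" using False SV frontier_not_empty[of V] by auto
  then have "1 / 2 ^ m \<le> setdist S (frontier V)"
    using False assms by (intro le_setdistI) (auto simp: inner_level_def frontier_def interior_open)
  then have "setdist S (frontier V) > 0"
    by (rule less_le_trans[rotated]) simp
  then show ?thesis using False SV assms(2)
    by (auto simp: uniformly_included_def bdry_dist_def)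
qed

section \<open>The exhaustion function\<close>

text \<open>A finite sum, so its regularity on any set follows without a convergence
  question.\<close>

definition exh_partial :: "'a::real_normed_vector set \<Rightarrow> nat \<Rightarrow> 'a \<Rightarrow> real" where
  "exh_partial V m z = 1 + (norm z)\<^sup>2 + (\<Sum>n<m. 4 ^ Suc n * (infdist z (inner_level V n))\<^sup>2)"

text \<open>The 1 gives positivity, the squared norm bounds the sublevel sets, and
  \<open>4 ^ Suc n\<close> cancels the squared gap \<open>1 / 2 ^ Suc n\<close>.\<close>

definition exh :: "'a::real_normed_vector set \<Rightarrow> 'a \<Rightarrow> real" where
  "exh V z = 1 + (norm z)\<^sup>2 + (\<Sum>n. 4 ^ Suc n * (infdist z (inner_level V n))\<^sup>2)"

text \<open>Levels increase, so \<open>z\<close> lies in every level from \<open>m\<close> on and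
  those distances vanish.\<close>

lemma exh_eq_partial:
  assumes "z \<in> inner_level V m"
  shows "exh V z = exh_partial V m z"
proof -
  have "infdist z (inner_level V n) = 0" if "m \<le> n" for n
    using assms inner_level_mono[OF that, of V] by (intro infdist_zero) auto
  then show ?thesis
    unfolding exh_def exh_partial_def by (subst suminf_finite[of "{..<m}"]) auto
qed

lemma exh_partial_ge: "1 + (norm z)\<^sup>2 \<le> exh_partial V m z"
  by (simp add: exh_partial_def sum_nonneg)

text \<open>Each index from \<open>k\<close> to \<open>m - 1\<close> contributes at least 1. The
  free \<open>l\<close> lets the sum be cut at a level that does contain \<open>z\<close>.\<close>

lemma exh_partial_gap:
  assumes "z \<notin> inner_level V m" "inner_level V k \<noteq> {}" "k \<le> m" "m \<le> l"
  shows "1 + real (m - k) \<le> exh_partial V l z"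
proof -
  have "real (m - k) = (\<Sum>n\<in>{k..<m}. 1)" by simp
  also have "\<dots> \<le> (\<Sum>n\<in>{k..<m}. 4 ^ Suc n * (infdist z (inner_level V n))\<^sup>2)"
  proof (rule sum_mono)
    fix n assume n: "n \<in> {k..<m}"
    have "inner_level V n \<noteq> {}" using n assms(2) inner_level_mono[of k n V] by auto
    then have "1 / 2 ^ Suc n \<le> infdist z (inner_level V n)"
      using inner_level_gap[OF assms(1)] n by simp
    then have "(1 / 2 ^ Suc n)\<^sup>2 \<le> (infdist z (inner_level V n))\<^sup>2"
      by (intro power_mono) auto
    also have "((1::real) / 2 ^ Suc n)\<^sup>2 = 1 / 4 ^ Suc n"
      by (simp add: power_divide power_mult_distrib power2_eq_square power_mult_distrib[symmetric])
    finally show "1 \<le> 4 ^ Suc n * (infdist z (inner_level V n))\<^sup>2"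
      by (simp add: field_simps)
  qed
  also have "\<dots> \<le> (\<Sum>n<l. 4 ^ Suc n * (infdist z (inner_level V n))\<^sup>2)"
    using assms by (intro sum_mono2) auto
  finally show ?thesis by (simp add: exh_partial_def add_increasing2 add_mono)
qed

lemma continuous_on_exh_partial: "continuous_on W (exh_partial V m)"
  unfolding exh_partial_def by (intro continuous_intros)

text \<open>The constant is left unsimplified to match the rules: 0 from the constant term, 1 from
  the squared norm, a weight times 1 from each squared distance.\<close>

lemma semiconcave_on_exh_partial:
  fixes V :: "'a::real_inner set"
  shows "semiconcave_on (0 + 1 + (\<Sum>n<m. 4 ^ Suc n * 1)) W (exh_partial V m)"
  unfolding exh_partial_def
  by (intro semiconcave_on_add semiconcave_on_const semiconcave_on_norm_square
      semiconcave_on_sum semiconcave_on_cmult semiconcave_on_infdist_square) auto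

lemma abs_square_diff_le:
  fixes a b :: real
  assumes "0 \<le> a" "a \<le> B" "0 \<le> b" "b \<le> B" "\<bar>a - b\<bar> \<le> d"
  shows "\<bar>a\<^sup>2 - b\<^sup>2\<bar> \<le> 2 * B * d"
proof -
  have "\<bar>a\<^sup>2 - b\<^sup>2\<bar> = (a + b) * \<bar>a - b\<bar>"
    using assms by (simp add: square_diff_square_factored power2_eq_square abs_mult)
  also have "\<dots> \<le> 2 * B * d"
    using assms by (intro mult_mono) auto
  finally show ?thesis .
qed

text \<open>The norm and all distance functions are 1-Lipschitz and bounded on \<open>S\<close>, so
  their squares are Lipschitz there.\<close>

lemma exh_partial_bounded_lipschitz:
  assumes "bounded S"
  obtains K L where "\<And>z. z \<in> S \<Longrightarrow> exh_partial V m z \<le> K"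
    "\<And>z w. z \<in> S \<Longrightarrow> w \<in> S \<Longrightarrow> \<bar>exh_partial V m z - exh_partial V m w\<bar> \<le> L * norm (z - w)"
proof -
  obtain B where B: "\<And>z. z \<in> S \<Longrightarrow> norm z \<le> B"
    using assms by (auto simp: bounded_iff)
  define D where "D n = infdist 0 (inner_level V n) + B" for n
  have D: "infdist z (inner_level V n) \<le> D n" if "z \<in> S" for z n
    using infdist_triangle[of z "inner_level V n" 0] B[OF that] by (simp add: D_def)
  show ?thesis
  proof (rule that)
    fix z assume z: "z \<in> S"
    show "exh_partial V m z \<le> 1 + B\<^sup>2 + (\<Sum>n<m. 4 ^ Suc n * (D n)\<^sup>2)"
      unfolding exh_partial_def
      by (intro add_mono sum_mono mult_left_mono power_mono infdist_nonneg D B z order_refl) auto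
    fix w assume w: "w \<in> S"
    have sq: "\<bar>(norm z)\<^sup>2 - (norm w)\<^sup>2\<bar> \<le> 2 * B * norm (z - w)"
      by (intro abs_square_diff_le B z w norm_triangle_ineq3) auto
    have "\<bar>\<Sum>n<m. 4 ^ Suc n * ((infdist z (inner_level V n))\<^sup>2 - (infdist w (inner_level V n))\<^sup>2)\<bar>
        \<le> (\<Sum>n<m. 4 ^ Suc n * (2 * D n * norm (z - w)))"
    proof (rule order_trans[OF sum_abs], rule sum_mono)
      fix n
      have "\<bar>(infdist z (inner_level V n))\<^sup>2 - (infdist w (inner_level V n))\<^sup>2\<bar> \<le> 2 * D n * norm (z - w)"
        by (intro abs_square_diff_le D z w infdist_nonneg)
           (metis infdist_triangle_abs dist_norm)
      then show "\<bar>4 ^ Suc n * ((infdist z (inner_level V n))\<^sup>2 - (infdist w (inner_level V n))\<^sup>2)\<bar>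
          \<le> 4 ^ Suc n * (2 * D n * norm (z - w))"
        by (simp add: abs_mult)
    qed
    with sq show "\<bar>exh_partial V m z - exh_partial V m w\<bar>
        \<le> (2 * B + (\<Sum>n<m. 4 ^ Suc n * (2 * D n))) * norm (z - w)"
      by (simp add: exh_partial_def sum_subtractf right_diff_distrib distrib_right sum_distrib_right
          mult.assoc abs_le_iff)
  qed
qed

section \<open>Properties of the full series on an open set\<close>

lemma exh_ge:
  assumes "open V" "z \<in> V"
  shows "1 + (norm z)\<^sup>2 \<le> exh V z"
  using open_ex_ball_subset_inner_level[OF assms] exh_eq_partial exh_partial_ge
  by (metis centre_in_ball subsetD)

lemma continuous_on_exh:
  assumes "open V"
  shows "continuous_on V (exh V)"
proof (rule continuous_at_imp_continuous_on, rule ballI)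
  fix z assume "z \<in> V"
  then obtain e m where e: "e > 0" "ball z e \<subseteq> inner_level V m"
    using open_ex_ball_subset_inner_level[OF assms] by blast
  have "continuous_on (ball z e) (exh V)"
    by (rule continuous_on_eq[OF continuous_on_exh_partial[of _ V m]])
       (use e exh_eq_partial in \<open>metis subsetD\<close>)
  then show "continuous (at z) (exh V)"
    using e by (simp add: continuous_on_eq_continuous_at)
qed

lemma semi_anti_psh_on_exh:
  assumes "open V"
  shows "semi_anti_psh_on V (exh V)"
  unfolding semi_anti_psh_on_def
proof (intro conjI allI impI)
  show "continuous_on V (exh V)" by (rule continuous_on_exh[OF assms])
  fix S assume "open S \<and> S \<noteq> {} \<and> uniformly_included S V"
  then have S: "open S" "uniformly_included S V" by auto
  obtain m where m: "S \<subseteq> inner_level V m"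
    using uniformly_included_imp_inner_level[OF S(2)] .
  \<comment> \<open>One truncation represents \<open>exh\<close> on all of \<open>S\<close>; its
    index fixes the semiconcavity constant.\<close>
  have "\<forall>z\<in>S. exh V z = exh_partial V m z" using m exh_eq_partial by blast
  then have "semiconcave_on (0 + 1 + (\<Sum>n<m. 4 ^ Suc n * 1)) S (exh V)"
    using semiconcave_on_exh_partial[of m S V] semiconcave_on_cong[of S "exh V" "exh_partial V m"]
    by blast
  moreover have "continuous_on S (exh V)"
    using continuous_on_exh[OF assms] m inner_level_subset by (meson continuous_on_subset)
  ultimately show "\<exists>C. globally_semi_anti_psh_on C S (exh V)"
    using semiconcave_imp_globally_semi_anti_psh_on S(1) by blast
qed

lemma exhaustion_function_on_exh:
  assumes "open V" "V \<noteq> {}"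
  shows "exhaustion_function_on V (exh V)"
  unfolding exhaustion_function_on_def
proof
  fix t
  \<comment> \<open>Empty levels contribute 0, so the counting of terms starts at a nonempty
    one.\<close>
  obtain k where k: "inner_level V k \<noteq> {}"
    using assms open_ex_ball_subset_inner_level[of V] by (metis all_not_in_conv centre_in_ball subsetD)
  obtain p :: nat where p: "t < real p" using reals_Archimedean2 by blast
  show "uniformly_included {z \<in> V. exh V z \<le> t} V"
  proof (rule inner_level_imp_uniformly_included[OF assms(1)])
    have "norm z \<le> t" if "z \<in> V" "exh V z \<le> t" for z
    proof -
      have "1 + (norm z)\<^sup>2 \<le> t" using exh_ge[OF assms(1) that(1)] that(2) by simp
      moreover have "2 * norm z \<le> 1 + (norm z)\<^sup>2"
        using sum_squares_bound[of 1 "norm z"] by simp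
      ultimately show ?thesis using norm_ge_zero[of z] by linarith
    qed
    then show "bounded {z \<in> V. exh V z \<le> t}" by (auto simp: bounded_iff)
    show "{z \<in> V. exh V z \<le> t} \<subseteq> inner_level V (k + p)"
    proof (rule subsetI, rule ccontr)
      fix z assume z: "z \<in> {z \<in> V. exh V z \<le> t}" "z \<notin> inner_level V (k + p)"
      obtain n where "z \<in> inner_level V n"
        using z(1) open_ex_ball_subset_inner_level[OF assms(1), of z]
        by (metis (lifting) CollectD centre_in_ball subsetD)
      \<comment> \<open>The maximum gives a level that contains \<open>z\<close> and is not below
        \<open>k + p\<close>, as \<open>exh_partial_gap\<close> requires.\<close>
      then have l: "z \<in> inner_level V (max n (k + p))"
        using inner_level_mono[of n "max n (k + p)" V] by auto
      have "1 + real (k + p - k) \<le> exh V z"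
        unfolding exh_eq_partial[OF l] by (intro exh_partial_gap z(2) k) auto
      then show False using z(1) p by simp
    qed
  qed
qed

theorem theorem4p1:
  fixes V :: "ell2 set"
  assumes "open V" and "V \<noteq> {}"
  shows "\<exists>\<Psi> :: ell2 \<Rightarrow> real.
    semi_anti_psh_on V \<Psi> \<and>
    (\<forall>z\<in>V. \<Psi> z > 0) \<and>
    exhaustion_function_on V \<Psi> \<and>
    (\<forall>S. uniformly_included S V \<longrightarrow>
      (SUP (z, \<zeta>) \<in> {(z, \<zeta>). z \<in> S \<and> \<zeta> \<in> S \<and> z \<noteq> \<zeta>}.
         ereal (\<Psi> z + \<bar>\<Psi> z - \<Psi> \<zeta>\<bar> / norm (z - \<zeta>))) < \<infinity>)"
proof (intro exI conjI ballI allI impI)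
  show "semi_anti_psh_on V (exh V)" by (rule semi_anti_psh_on_exh[OF assms(1)])
  show "exhaustion_function_on V (exh V)" by (rule exhaustion_function_on_exh[OF assms])
  show "exh V z > 0" if "z \<in> V" for z
    using exh_ge[OF assms(1) that] zero_le_power2[of "norm z"] by linarith
  fix S assume S: "uniformly_included S V"
  obtain m where m: "S \<subseteq> inner_level V m"
    using uniformly_included_imp_inner_level[OF S] .
  have "bounded S" using S by (auto simp: uniformly_included_def)
  then obtain K L where K: "\<And>z. z \<in> S \<Longrightarrow> exh_partial V m z \<le> K"
    and L: "\<And>z w. z \<in> S \<Longrightarrow> w \<in> S \<Longrightarrow> \<bar>exh_partial V m z - exh_partial V m w\<bar> \<le> L * norm (z - w)"
    using exh_partial_bounded_lipschitz by metis
  have "exh V z + \<bar>exh V z - exh V w\<bar> / norm (z - w) \<le> K + L" if "z \<in> S" "w \<in> S" "z \<noteq> w" for z w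
  proof (rule add_mono)
    have eq: "exh V z = exh_partial V m z" "exh V w = exh_partial V m w"
      using that m by (auto intro: exh_eq_partial)
    show "exh V z \<le> K" using K that eq by simp
    show "\<bar>exh V z - exh V w\<bar> / norm (z - w) \<le> L"
      using L[OF that(1,2)] that(3) by (simp add: eq pos_divide_le_eq)
  qed
  \<comment> \<open>If \<open>S\<close> has fewer than two points, this is the supremum of the empty
    set, minus infinity in \<open>ereal\<close>, and the bound still holds.\<close>
  then have "(SUP (z, \<zeta>) \<in> {(z, \<zeta>). z \<in> S \<and> \<zeta> \<in> S \<and> z \<noteq> \<zeta>}.
      ereal (exh V z + \<bar>exh V z - exh V \<zeta>\<bar> / norm (z - \<zeta>))) \<le> ereal (K + L)"
    by (intro SUP_least) auto
  then show "(SUP (z, \<zeta>) \<in> {(z, \<zeta>). z \<in> S \<and> \<zeta> \<in> S \<and> z \<noteq> \<zeta>}.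
      ereal (exh V z + \<bar>exh V z - exh V \<zeta>\<bar> / norm (z - \<zeta>))) < \<infinity>"
    by (rule le_less_trans) simp
qed

end
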